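(* Let $k\in\mathbb N^+$. A $k$-monoid $H$ has index $1$ (that is, $\mathrm{ind}\,H=1$) if and only if there exists $f\in\mathbb N^k$ such that $H\subseteq\langle f\rangle$.
   Context: $\mathbb N=\{0,1,2,\ldots\}$, $\mathbb N^+=\mathbb N\setminus\{0\}$. A $k$-monoid is a submonoid of $(\mathbb N^k,+)$. An isomorphism between a $k$-monoid and an $l$-monoid is a bijective additive map; $\cong$ denotes isomorphism. $\mathrm{ind}\,H=\min\{r\in\mathbb N^+: H\cong K\text{ for some }r\text{-monoid }K\}$. $\langle f\rangle=\{nf:n\in\mathbb N\}$ is the submonoid of $\mathbb N^k$ generated by $f$. *)

theory Defs
  imports "HOL-Algebra.Group"
begin

text \<open>
  The dimension is quantified over inside the definition of the index, so it cannot be a type.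
  A vector in \<open>\<nat>\<^sup>k\<close> is a function that vanishes at every index \<open>i \<ge> k\<close>.
  The monoid operation is addition, although the record notation is multiplicative.
\<close>

definition nat_vec :: "nat \<Rightarrow> (nat \<Rightarrow> nat) monoid"
  where "nat_vec k =
    \<lparr>carrier = {x. \<forall>i\<ge>k. x i = 0}, mult = (\<lambda>x y i. x i + y i), one = (\<lambda>_. 0)\<rparr>"

lemma comm_monoid_nat_vec: "comm_monoid (nat_vec k)"
  by (rule comm_monoidI) (auto simp: nat_vec_def)

abbreviation k_monoid :: "nat \<Rightarrow> (nat \<Rightarrow> nat) set \<Rightarrow> bool"
  where "k_monoid k H \<equiv> submonoid H (nat_vec k)"

abbreviation as_monoid :: "nat \<Rightarrow> (nat \<Rightarrow> nat) set \<Rightarrow> (nat \<Rightarrow> nat) monoid"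
  where "as_monoid k H \<equiv> (nat_vec k)\<lparr>carrier := H\<rparr>"

text \<open>
  The index is only meaningful for monoids isomorphic to some \<open>r\<close>-monoid with \<open>r > 0\<close>. This
  holds for every \<open>k\<close>-monoid with \<open>k > 0\<close>, so the minimum is then taken over a nonempty set
  (lemma \<open>mon_index_wellposed\<close>). Library isomorphisms need not be assumed to preserve the unit;
  they are exactly the bijective additive maps.
\<close>

definition mon_index :: "(nat \<Rightarrow> nat) monoid \<Rightarrow> nat"
  where "mon_index G = (LEAST r. r > 0 \<and> (\<exists>K. k_monoid r K \<and> G \<cong> as_monoid r K))"

lemma mon_index_wellposed:
  assumes "k > 0" "k_monoid k H"
  shows "\<exists>r>0. \<exists>K. k_monoid r K \<and> as_monoid k H \<cong> as_monoid r K"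
  using assms iso_refl by blast

definition multiples :: "(nat \<Rightarrow> nat) \<Rightarrow> (nat \<Rightarrow> nat) set"
  where "multiples f = {(\<lambda>i. n * f i) | n. True}"

lemma multiples_eq_pow: "multiples f = {f [^]\<^bsub>nat_vec k\<^esub> n | n :: nat. True}"
proof -
  have "f [^]\<^bsub>nat_vec k\<^esub> n = (\<lambda>i. n * f i)" for n :: nat
    by (induction n) (auto simp: nat_vec_def nat_pow_def fun_eq_iff)
  then show ?thesis by (simp add: multiples_def)
qed

end

theory Submission
  imports Defs
begin

text \<open>
  Index \<open>1\<close> means that \<open>H\<close> embeds additively into \<open>\<nat>\<close>. Such an embedding \<open>g\<close> forces any two
  elements \<open>x, y\<close> of \<open>H\<close> to be proportional: \<open>g y \<cdot> x\<close> and \<open>g x \<cdot> y\<close> both lie in \<open>H\<close> and both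
  have image \<open>g x \<cdot> g y\<close>, so they coincide (\<open>additive_injection_proportional\<close>). Hence \<open>H\<close> lies on
  one line through the origin, and the points of \<open>\<nat>\<^sup>k\<close> on a line through a nonzero \<open>h\<close> are the
  multiples of the primitive vector \<open>h / gcd h\<close> (\<open>proportional_in_multiples\<close>). Conversely, a
  coordinate that does not vanish at \<open>f\<close> separates the multiples of \<open>f\<close>
  (\<open>inj_on_coordinate_multiples\<close>), so projecting to it embeds \<open>H\<close> into \<open>\<nat>\<close>.
\<close>

lemma k_monoid_zero:
  assumes "k_monoid k H"
  shows "(\<lambda>_. 0) \<in> H"
  using submonoid.one_closed[OF assms] by (simp add: nat_vec_def)

lemma k_monoid_add:
  assumes "k_monoid k H" "x \<in> H" "y \<in> H"
  shows "(\<lambda>i. x i + y i) \<in> H"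
  using submonoid.m_closed[OF assms] by (simp add: nat_vec_def)

lemma k_monoid_vanishes:
  assumes "k_monoid k H" "x \<in> H" "i \<ge> k"
  shows "x i = 0"
  using submonoid.subset[OF assms(1)] assms(2,3) by (auto simp: nat_vec_def)

lemma mon_index_eq_1_iff:
  assumes "k > 0" "k_monoid k H"
  shows "mon_index (as_monoid k H) = 1 \<longleftrightarrow> (\<exists>K. k_monoid 1 K \<and> as_monoid k H \<cong> as_monoid 1 K)"
proof
  assume "mon_index (as_monoid k H) = 1"
  then show "\<exists>K. k_monoid 1 K \<and> as_monoid k H \<cong> as_monoid 1 K"
    using LeastI_ex[OF mon_index_wellposed[OF assms]] by (simp add: mon_index_def)
next
  assume "\<exists>K. k_monoid 1 K \<and> as_monoid k H \<cong> as_monoid 1 K"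
  then show "mon_index (as_monoid k H) = 1"
    unfolding mon_index_def by (intro Least_equality) auto
qed

lemma additive_scale:
  fixes g :: "(nat \<Rightarrow> nat) \<Rightarrow> nat"
  assumes H: "k_monoid k H"
    and add: "\<And>x y. x \<in> H \<Longrightarrow> y \<in> H \<Longrightarrow> g (\<lambda>i. x i + y i) = g x + g y"
    and "x \<in> H"
  shows "(\<lambda>i. n * x i) \<in> H \<and> g (\<lambda>i. n * x i) = n * g x"
proof (induction n)
  case 0
  have "g (\<lambda>_. 0) = 0"
    using add[OF k_monoid_zero[OF H] k_monoid_zero[OF H]] by simp
  then show ?case by (simp add: k_monoid_zero[OF H])
next
  case (Suc n)
  then show ?case
    using k_monoid_add[OF H \<open>x \<in> H\<close>, of "\<lambda>i. n * x i"] add[OF \<open>x \<in> H\<close>, of "\<lambda>i. n * x i"]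
    by simp
qed

text \<open>
  Both \<open>g y \<cdot> x\<close> and \<open>g x \<cdot> y\<close> lie in \<open>H\<close> and are sent to \<open>g x \<cdot> g y\<close>, so injectivity
  identifies them.
\<close>

lemma additive_injection_proportional:
  fixes g :: "(nat \<Rightarrow> nat) \<Rightarrow> nat"
  assumes H: "k_monoid k H"
    and add: "\<And>x y. x \<in> H \<Longrightarrow> y \<in> H \<Longrightarrow> g (\<lambda>i. x i + y i) = g x + g y"
    and inj: "inj_on g H"
    and x: "x \<in> H" and y: "y \<in> H"
  shows "g y * x i = g x * y i"
proof -
  have scale: "(\<lambda>i. n * z i) \<in> H \<and> g (\<lambda>i. n * z i) = n * g z" if "z \<in> H" for z n
    using H add that by (rule additive_scale)
  have "g (\<lambda>i. g y * x i) = g (\<lambda>i. g x * y i)"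
    using scale[OF x] scale[OF y] by simp
  then have "(\<lambda>i. g y * x i) = (\<lambda>i. g x * y i)"
    using scale[OF x] scale[OF y] by (intro inj_onD[OF inj]) blast+
  then show ?thesis by (rule fun_cong)
qed

text \<open>
  Scaling a vector scales the greatest common divisor of its entries, so \<open>a \<cdot> x = b \<cdot> h\<close> gives
  \<open>a \<cdot> gcd x = b \<cdot> gcd h\<close>. This makes the rational factor between \<open>x\<close> and the primitive vector
  \<open>h / gcd h\<close> equal to the natural number \<open>gcd x\<close>.
\<close>

lemma proportional_in_multiples:
  fixes h x :: "nat \<Rightarrow> nat"
  assumes scaled_eq: "\<And>i. a * x i = b * h i" and "a > 0"
  shows "x \<in> multiples (\<lambda>i. h i div Gcd (range h))"
proof -
  let ?f = "\<lambda>i. h i div Gcd (range h)"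
  have h: "h i = Gcd (range h) * ?f i" for i
    by (simp add: Gcd_dvd)
  have scale: "Gcd (range (\<lambda>i. c * y i)) = c * Gcd (range y)" for c and y :: "nat \<Rightarrow> nat"
    using Gcd_mult[of c "range y"] by (simp add: image_image)
  have gcds: "a * Gcd (range x) = b * Gcd (range h)"
    using scaled_eq by (simp flip: scale)
  have "x i = Gcd (range x) * ?f i" for i
  proof -
    have "a * x i = b * Gcd (range h) * ?f i"
      using scaled_eq[of i] h[of i] by (simp add: mult.assoc)
    also have "\<dots> = a * (Gcd (range x) * ?f i)"
      by (simp add: mult.assoc flip: gcds)
    finally show ?thesis using \<open>a > 0\<close> by simp
  qed
  then show ?thesis by (auto simp: multiples_def)
qed

lemma additive_injection_imp_subset_multiples:
  fixes g :: "(nat \<Rightarrow> nat) \<Rightarrow> nat"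
  assumes H: "k_monoid k H"
    and add: "\<And>x y. x \<in> H \<Longrightarrow> y \<in> H \<Longrightarrow> g (\<lambda>i. x i + y i) = g x + g y"
    and inj: "inj_on g H"
  shows "\<exists>f \<in> carrier (nat_vec k). H \<subseteq> multiples f"
proof (cases "\<exists>h \<in> H. g h > 0")
  case True
  then obtain h where h: "h \<in> H" "g h > 0" by blast
  have "x \<in> multiples (\<lambda>i. h i div Gcd (range h))" if "x \<in> H" for x
    using additive_injection_proportional[where g = g, OF H add inj that \<open>h \<in> H\<close>] h
    by (intro proportional_in_multiples[of "g h" x "g x"])
  moreover have "(\<lambda>i. h i div Gcd (range h)) \<in> carrier (nat_vec k)"
    using k_monoid_vanishes[OF H \<open>h \<in> H\<close>] by (simp add: nat_vec_def)
  ultimately show ?thesis by blast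
next
  \<comment> \<open>Here \<open>g\<close> is both injective and zero on \<open>H\<close>, so \<open>H\<close> is trivial.\<close>
  case False
  then have "x = (\<lambda>_. 0)" if "x \<in> H" for x
    using inj_onD[OF inj _ that k_monoid_zero[OF H]] k_monoid_zero[OF H] that by auto
  then have "H \<subseteq> multiples (\<lambda>_. 0)" by (auto simp: multiples_def)
  then show ?thesis by (intro bexI[of _ "\<lambda>_. 0"]) (auto simp: nat_vec_def)
qed

lemma inj_on_coordinate_multiples:
  assumes "f j > 0"
  shows "inj_on (\<lambda>x. x j) (multiples f)"
  using assms by (auto simp: inj_on_def multiples_def)

text \<open>
  The vectors of \<open>\<nat>\<^sup>1\<close> are functions supported at \<open>0\<close>, so the chosen coordinate \<open>j\<close> is moved to
  index \<open>0\<close>.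
\<close>

lemma coordinate_injective_imp_iso_1_monoid:
  assumes H: "k_monoid k H" and inj: "inj_on (\<lambda>x. x j) H"
  shows "\<exists>K. k_monoid 1 K \<and> as_monoid k H \<cong> as_monoid 1 K"
proof -
  define p :: "(nat \<Rightarrow> nat) \<Rightarrow> nat \<Rightarrow> nat" where "p x = (\<lambda>i. if i = 0 then x j else 0)" for x
  have p_add: "p (\<lambda>i. x i + y i) = (\<lambda>i. p x i + p y i)" for x y
    by (auto simp: p_def)
  have "k_monoid 1 (p ` H)"
  proof
    show "p ` H \<subseteq> carrier (nat_vec 1)"
      by (auto simp: p_def nat_vec_def)
    show "x \<otimes>\<^bsub>nat_vec 1\<^esub> y \<in> p ` H" if "x \<in> p ` H" "y \<in> p ` H" for x y
      using that k_monoid_add[OF H] by (auto simp: nat_vec_def simp flip: p_add)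
    show "\<one>\<^bsub>nat_vec 1\<^esub> \<in> p ` H"
      using k_monoid_zero[OF H] by (intro image_eqI[of _ _ "\<lambda>_. 0"]) (auto simp: p_def nat_vec_def)
  qed
  moreover have "p \<in> iso (as_monoid k H) (as_monoid 1 (p ` H))"
  proof -
    have "inj_on p H"
      using inj by (auto simp: inj_on_def p_def dest: fun_cong[of _ _ 0])
    then show ?thesis
      by (auto simp: iso_def hom_def bij_betw_def p_add nat_vec_def)
  qed
  ultimately show ?thesis by (auto simp: is_iso_def)
qed

lemma iso_1_monoid_imp_additive_injection:
  assumes "k_monoid 1 K" and "as_monoid k H \<cong> as_monoid 1 K"
  obtains g :: "(nat \<Rightarrow> nat) \<Rightarrow> nat"
  where "\<And>x y. x \<in> H \<Longrightarrow> y \<in> H \<Longrightarrow> g (\<lambda>i. x i + y i) = g x + g y" and "inj_on g H"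
proof -
  obtain \<phi> where "\<phi> \<in> iso (as_monoid k H) (as_monoid 1 K)"
    using assms(2) by (auto simp: is_iso_def)
  then have \<phi>_add: "\<And>x y. x \<in> H \<Longrightarrow> y \<in> H \<Longrightarrow> \<phi> (\<lambda>i. x i + y i) = (\<lambda>i. \<phi> x i + \<phi> y i)"
    and \<phi>_bij: "bij_betw \<phi> H K"
    by (auto simp: iso_def hom_def nat_vec_def)
  have "x = y" if "x \<in> H" "y \<in> H" "\<phi> x 0 = \<phi> y 0" for x y
  proof -
    have "\<phi> x i = \<phi> y i" for i
      using k_monoid_vanishes[OF assms(1), of "\<phi> x" i] k_monoid_vanishes[OF assms(1), of "\<phi> y" i]
        bij_betwE[OF \<phi>_bij] that
      by (cases "i = 0") auto
    then show ?thesis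
      using \<phi>_bij that by (auto simp: bij_betw_def inj_on_def fun_eq_iff)
  qed
  then show ?thesis
    using that[of "\<lambda>x. \<phi> x 0"] \<phi>_add by (auto simp: inj_on_def)
qed

theorem proposition3p2:
  fixes k :: nat and H :: "(nat \<Rightarrow> nat) set"
  assumes "k > 0" and "k_monoid k H"
  shows "mon_index (as_monoid k H) = 1 \<longleftrightarrow> (\<exists>f \<in> carrier (nat_vec k). H \<subseteq> multiples f)"
  unfolding mon_index_eq_1_iff[OF assms]
proof
  assume "\<exists>K. k_monoid 1 K \<and> as_monoid k H \<cong> as_monoid 1 K"
  then obtain K where K: "k_monoid 1 K" "as_monoid k H \<cong> as_monoid 1 K" by blast
  obtain g :: "(nat \<Rightarrow> nat) \<Rightarrow> nat"
    where "\<And>x y. x \<in> H \<Longrightarrow> y \<in> H \<Longrightarrow> g (\<lambda>i. x i + y i) = g x + g y" and "inj_on g H"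
    using iso_1_monoid_imp_additive_injection[OF K] by blast
  then show "\<exists>f \<in> carrier (nat_vec k). H \<subseteq> multiples f"
    by (rule additive_injection_imp_subset_multiples[OF assms(2)])
next
  assume "\<exists>f \<in> carrier (nat_vec k). H \<subseteq> multiples f"
  then obtain f where f: "H \<subseteq> multiples f" by blast
  have "\<exists>j. inj_on (\<lambda>x. x j) (multiples f)"
  proof (cases "\<exists>j. f j > 0")
    case True
    then show ?thesis using inj_on_coordinate_multiples by blast
  next
    \<comment> \<open>The only multiple of \<open>f = 0\<close> is \<open>0\<close>, so every coordinate is injective.\<close>
    case False
    then show ?thesis by (auto simp: inj_on_def multiples_def)
  qed
  then obtain j where "inj_on (\<lambda>x. x j) H"
    using f inj_on_subset by blast
  then show "\<exists>K. k_monoid 1 K \<and> as_monoid k H \<cong> as_monoid 1 K"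
    by (rule coordinate_injective_imp_iso_1_monoid[OF assms(2)])
qed

end
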